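(* Let $R=f(\mathbf{L})$ with $f$ injective on $\operatorname{spec}(\mathbf{L})$, where $\mathbf{L}$ is the Laplacian of a graph on $M$ vertices, and suppose that in the sequential eigenvalue procedure with deflation the positive-overlap hypothesis $\max_{\sigma\in S_M}\langle A^\ast_{k+1},\mathbf{P}_\sigma\rangle_F>0$ holds at every stage. Call the candidate basis $\mathcal{B}$ generating-complete for $R$ if, at every stage with $G_k\subsetneq\operatorname{Aut}(R)$, the rounding step (S3) returns a permutation $\sigma^\ast_{k+1}\in\operatorname{Aut}(R)\setminus G_k$. If $\mathcal{B}$ is generating-complete, then the sequential procedure at $\tau=0$ halts with $G_K=\operatorname{Aut}(R)$, the full automorphism group.
   Context: $\mathbf{P}_\sigma$ is the permutation matrix of $\sigma\in S_M$, and $\operatorname{Aut}(R)=\{\sigma\in S_M:\mathbf{P}_\sigma R=R\mathbf{P}_\sigma\}$. $R$ is Hermitian. $\langle X,Y\rangle_F=\operatorname{Tr}(X^HY)$; $\|\cdot\|_F$ is the Frobenius norm; $[X,Y]=XY-YX$; $\delta(A,R)=\|[R,A]\|_F/(\|R\|_F\|A\|_F)$. $\mathcal{B}$ is a finite set of candidate generators in $\mathbb{C}^{M\times M}$. Procedure: initialize $G_0=\{e\}\le S_M$, $k=0$, with acceptance threshold $\tau\ge0$ and iteration cap $K_{\max}$. (S1) Form $\mathcal{B}^{\perp G_k}$, the Frobenius-orthogonal complement of $\operatorname{span}\{\mathbf{P}_g:g\in G_k\}$ within $\operatorname{span}(\mathcal{B})$ (so its elements are orthogonal to every $\mathbf{P}_g$,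 $g\in G_k$). (S2) Let $A^\ast_{k+1}\in\mathcal{B}^{\perp G_k}$, $\|A^\ast_{k+1}\|_F=1$, be a minimizer of $\|[R,A]\|_F^2/\|A\|_F^2$ over nonzero $A\in\mathcal{B}^{\perp G_k}$. (S3) Round to the nearest permutation, $\sigma^\ast_{k+1}=\arg\max_{\sigma\in S_M}\langle A^\ast_{k+1},\mathbf{P}_\sigma\rangle_F$. (S4) If $\delta(\mathbf{P}_{\sigma^\ast_{k+1}},R)>\tau$, terminate and return $G_k$. (S5) Otherwise (accept) set $G_{k+1}=\langle G_k,\sigma^\ast_{k+1}\rangle$, increment $k$, and repeat unless $k\ge K_{\max}$. $G_K$ is the group returned.
   Formalization: The claim fails if the cap K_max is too small (empty graph on 3 vertices, candidate basis {P_(123)}, K_max = 1 returns A_3); the formal theorem adds that K_max is at least floor(log2 |Aut(R)|) or that the run is not stopped by the cap. *)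

theory Defs
  imports "HOL-Analysis.Analysis" "HOL-Algebra.Bij" "HOL-Algebra.Generated_Groups"
begin

section \<open>Matrices over the complex numbers\<close>

type_synonym 'n cmat = "complex^'n^'n"

definition conj_transpose :: "'n::finite cmat \<Rightarrow> 'n cmat" where
  "conj_transpose X = (\<chi> i j. cnj (X $ j $ i))"

definition hermitian_mat :: "'n::finite cmat \<Rightarrow> bool" where
  "hermitian_mat X \<longleftrightarrow> conj_transpose X = X"

definition unitary_mat :: "'n::finite cmat \<Rightarrow> bool" where
  "unitary_mat U \<longleftrightarrow> conj_transpose U ** U = mat 1 \<and> U ** conj_transpose U = mat 1"

definition frob_inner :: "'n::finite cmat \<Rightarrow> 'n cmat \<Rightarrow> complex" where
  "frob_inner X Y = trace (conj_transpose X ** Y)"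

text \<open>The library norm on \<^typ>\<open>complex^'n^'n\<close> is the Frobenius norm.\<close>

lemma norm_eq_frobenius:
  fixes X :: "'n::finite cmat"
  shows "norm X = sqrt (Re (frob_inner X X))"
proof -
  have "(norm X)\<^sup>2 = (\<Sum>i\<in>UNIV. \<Sum>j\<in>UNIV. (norm (X $ i $ j))\<^sup>2)"
    by (simp add: norm_vec_def L2_set_def sum_nonneg real_sqrt_pow2)
  also have "\<dots> = (\<Sum>j\<in>UNIV. \<Sum>i\<in>UNIV. (norm (X $ i $ j))\<^sup>2)"
    by (rule sum.swap)
  also have "\<dots> = Re (frob_inner X X)"
    unfolding cmod_power2
    by (simp add: frob_inner_def trace_def conj_transpose_def matrix_matrix_mult_def
        power2_eq_square)
  finally show ?thesis
    by (metis norm_ge_zero real_sqrt_unique)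
qed

definition commutator :: "'n::finite cmat \<Rightarrow> 'n cmat \<Rightarrow> 'n cmat" where
  "commutator X Y = X ** Y - Y ** X"

text \<open>If \<open>R = 0\<close> the quotient is \<open>0 / 0 = 0\<close>, i.e. every \<open>A\<close> counts as commuting with \<open>R\<close>.\<close>

definition defect :: "'n::finite cmat \<Rightarrow> 'n cmat \<Rightarrow> real" where
  "defect A R = norm (commutator R A) / (norm R * norm A)"

text \<open>The library's \<^const>\<open>span\<close> on this type is the real span; spans of matrices are complex here.\<close>

definition cscale :: "complex \<Rightarrow> 'n::finite cmat \<Rightarrow> 'n cmat" where
  "cscale c X = (\<chi> i j. c * X $ i $ j)"

interpretation cmat: vector_space "cscale :: complex \<Rightarrow> 'n::finite cmat \<Rightarrow> 'n cmat"
  by unfold_locales (simp_all add: cscale_def vec_eq_iff algebra_simps)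

section \<open>Graph Laplacians and functions of a matrix\<close>

definition simple_graph :: "('n \<Rightarrow> 'n \<Rightarrow> bool) \<Rightarrow> bool" where
  "simple_graph E \<longleftrightarrow> symp E \<and> irreflp E"

definition laplacian :: "('n::finite \<Rightarrow> 'n \<Rightarrow> bool) \<Rightarrow> 'n cmat" where
  "laplacian E = (\<chi> i j. (if i = j then of_nat (card {k. E i k}) else 0) - (if E i j then 1 else 0))"

definition spec :: "'n::finite cmat \<Rightarrow> complex set" where
  "spec X = {c. \<exists>v. v \<noteq> 0 \<and> X *v v = c *s v}"

definition diag_mat :: "('n::finite \<Rightarrow> complex) \<Rightarrow> 'n cmat" where
  "diag_mat d = (\<chi> i j. if i = j then d i else 0)"

text \<open>\<open>R = f(L)\<close> in the functional calculus of a normal matrix: \<open>L = U diag(d) U\<^sup>H\<close> and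
  \<open>R = U diag(f(d)) U\<^sup>H\<close> with \<open>U\<close> unitary. The matrix \<open>R\<close> does not depend on the choice of
  the diagonalisation, and one exists for every Laplacian by the spectral theorem.\<close>

definition is_matrix_fun :: "(complex \<Rightarrow> complex) \<Rightarrow> 'n::finite cmat \<Rightarrow> 'n cmat \<Rightarrow> bool" where
  "is_matrix_fun f L R \<longleftrightarrow> (\<exists>U d. unitary_mat U \<and>
     L = U ** diag_mat d ** conj_transpose U \<and>
     R = U ** diag_mat (f \<circ> d) ** conj_transpose U)"

section \<open>Permutations\<close>

text \<open>The symmetric group on the vertex type; its elements are the bijections of the type.\<close>

abbreviation Sym :: "('n \<Rightarrow> 'n) monoid" where
  "Sym \<equiv> BijGroup UNIV"

lemma carrier_Sym: "carrier Sym = {\<sigma>. bij \<sigma>}"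
  by (auto simp: BijGroup_def Bij_def)

lemma mult_Sym: "bij \<sigma> \<Longrightarrow> bij \<tau> \<Longrightarrow> \<sigma> \<otimes>\<^bsub>Sym\<^esub> \<tau> = \<sigma> \<circ> \<tau>"
  by (auto simp: BijGroup_def Bij_def compose_def)

lemma one_Sym: "\<one>\<^bsub>Sym\<^esub> = id"
  by (auto simp: BijGroup_def)

text \<open>Column \<open>j\<close> is the unit vector with index \<open>\<sigma> j\<close>, so that \<open>\<sigma> \<mapsto> perm_mat \<sigma>\<close> is multiplicative.\<close>

definition perm_mat :: "('n::finite \<Rightarrow> 'n) \<Rightarrow> 'n cmat" where
  "perm_mat \<sigma> = (\<chi> i j. if i = \<sigma> j then 1 else 0)"

definition Aut :: "'n::finite cmat \<Rightarrow> ('n \<Rightarrow> 'n) set" where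
  "Aut R = {\<sigma> \<in> carrier Sym. perm_mat \<sigma> ** R = R ** perm_mat \<sigma>}"

section \<open>The sequential procedure with deflation\<close>

definition deflated :: "'n::finite cmat set \<Rightarrow> ('n \<Rightarrow> 'n) set \<Rightarrow> 'n cmat set" where
  "deflated B H = {A \<in> cmat.span B. \<forall>X \<in> cmat.span (perm_mat ` H). frob_inner X A = 0}"

definition is_optimal_generator ::
  "'n::finite cmat set \<Rightarrow> 'n cmat \<Rightarrow> ('n \<Rightarrow> 'n) set \<Rightarrow> 'n cmat \<Rightarrow> bool" where
  "is_optimal_generator B R H A \<longleftrightarrow> norm A = 1 \<and>
     is_arg_min (\<lambda>X. (norm (commutator R X))\<^sup>2 / (norm X)\<^sup>2) (\<lambda>X. X \<in> deflated B H \<and> X \<noteq> 0) A"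

text \<open>\<open>A\<close> may be complex, so the overlap is the real part of the inner product: since
  \<open>\<parallel>A - P\<^sub>\<sigma>\<parallel>\<^sup>2 = \<parallel>A\<parallel>\<^sup>2 + M - 2 Re \<langle>A, P\<^sub>\<sigma>\<rangle>\<close>, maximising it yields the nearest permutation matrix.\<close>

definition overlap :: "'n::finite cmat \<Rightarrow> ('n \<Rightarrow> 'n) \<Rightarrow> real" where
  "overlap A \<sigma> = Re (frob_inner A (perm_mat \<sigma>))"

definition is_rounding :: "'n::finite cmat \<Rightarrow> ('n \<Rightarrow> 'n) \<Rightarrow> bool" where
  "is_rounding A \<sigma> \<longleftrightarrow> is_arg_max (overlap A) (\<lambda>\<sigma>. \<sigma> \<in> carrier Sym) \<sigma>"

text \<open>Minimisers and roundings need not be unique, so a run of the procedure is recorded by the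
  choices it makes. Entries of the three sequences beyond the point where the run stops
  are irrelevant.\<close>

record 'n run =
  grp :: "nat \<Rightarrow> ('n \<Rightarrow> 'n) set"
  gen :: "nat \<Rightarrow> 'n cmat"
  prm :: "nat \<Rightarrow> 'n \<Rightarrow> 'n"

text \<open>If the deflated space is zero, there is nothing to minimise over; the procedure then stops
  and returns the current group.\<close>

definition has_candidate :: "'n::finite cmat set \<Rightarrow> 'n run \<Rightarrow> nat \<Rightarrow> bool" where
  "has_candidate B \<rho> k \<longleftrightarrow> (\<exists>A \<in> deflated B (grp \<rho> k). A \<noteq> 0)"

definition accepts ::
  "'n::finite cmat set \<Rightarrow> 'n cmat \<Rightarrow> real \<Rightarrow> 'n run \<Rightarrow> nat \<Rightarrow> bool" where
  "accepts B R \<tau> \<rho> k \<longleftrightarrow> has_candidate B \<rho> k \<and> defect (perm_mat (prm \<rho> (Suc k))) R \<le> \<tau>"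

text \<open>Stage \<open>k\<close> is reached if every earlier stage accepted and did not exhaust the iteration cap.
  The cap is tested only after an acceptance, so stage \<open>0\<close> is always entered.\<close>

definition stage ::
  "'n::finite cmat set \<Rightarrow> 'n cmat \<Rightarrow> real \<Rightarrow> nat \<Rightarrow> 'n run \<Rightarrow> nat \<Rightarrow> bool" where
  "stage B R \<tau> Kmax \<rho> k \<longleftrightarrow> (\<forall>j<k. accepts B R \<tau> \<rho> j \<and> Suc j < Kmax)"

definition sequential_run ::
  "'n::finite cmat set \<Rightarrow> 'n cmat \<Rightarrow> real \<Rightarrow> nat \<Rightarrow> 'n run \<Rightarrow> bool" where
  "sequential_run B R \<tau> Kmax \<rho> \<longleftrightarrow>
     grp \<rho> 0 = {\<one>\<^bsub>Sym\<^esub>} \<and>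
     (\<forall>k. stage B R \<tau> Kmax \<rho> k \<and> has_candidate B \<rho> k \<longrightarrow>
        is_optimal_generator B R (grp \<rho> k) (gen \<rho> (Suc k)) \<and>
        is_rounding (gen \<rho> (Suc k)) (prm \<rho> (Suc k)) \<and>
        (accepts B R \<tau> \<rho> k \<longrightarrow>
           grp \<rho> (Suc k) = generate Sym (insert (prm \<rho> (Suc k)) (grp \<rho> k))))"

definition cap_stops ::
  "'n::finite cmat set \<Rightarrow> 'n cmat \<Rightarrow> real \<Rightarrow> nat \<Rightarrow> 'n run \<Rightarrow> nat \<Rightarrow> bool" where
  "cap_stops B R \<tau> Kmax \<rho> K \<longleftrightarrow>
     (\<exists>k. K = Suc k \<and> stage B R \<tau> Kmax \<rho> k \<and> accepts B R \<tau> \<rho> k \<and> Kmax \<le> K)"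

text \<open>The run halts and returns the group with index \<open>K\<close>.\<close>

definition halts_at ::
  "'n::finite cmat set \<Rightarrow> 'n cmat \<Rightarrow> real \<Rightarrow> nat \<Rightarrow> 'n run \<Rightarrow> nat \<Rightarrow> bool" where
  "halts_at B R \<tau> Kmax \<rho> K \<longleftrightarrow>
     (stage B R \<tau> Kmax \<rho> K \<and> \<not> accepts B R \<tau> \<rho> K) \<or> cap_stops B R \<tau> Kmax \<rho> K"

definition positive_overlap ::
  "'n::finite cmat set \<Rightarrow> 'n cmat \<Rightarrow> real \<Rightarrow> nat \<Rightarrow> 'n run \<Rightarrow> bool" where
  "positive_overlap B R \<tau> Kmax \<rho> \<longleftrightarrow>
     (\<forall>k. stage B R \<tau> Kmax \<rho> k \<and> has_candidate B \<rho> k \<longrightarrow>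
        Max (overlap (gen \<rho> (Suc k)) ` carrier Sym) > 0)"

definition generating_complete ::
  "'n::finite cmat set \<Rightarrow> 'n cmat \<Rightarrow> real \<Rightarrow> nat \<Rightarrow> 'n run \<Rightarrow> bool" where
  "generating_complete B R \<tau> Kmax \<rho> \<longleftrightarrow>
     (\<forall>k. stage B R \<tau> Kmax \<rho> k \<and> grp \<rho> k \<subset> Aut R \<longrightarrow>
        has_candidate B \<rho> k \<and> prm \<rho> (Suc k) \<in> Aut R - grp \<rho> k)"

text \<open>A run cut off by the cap may return too small a group. An accepted permutation outside the
  current group at least doubles its order, so a cap of at least \<open>\<lfloor>log\<^sub>2 |Aut R|\<rfloor>\<close> always
  suffices; a smaller cap does no harm if the run stops for another reason.\<close>

definition cap_harmless ::
  "'n::finite cmat set \<Rightarrow> 'n cmat \<Rightarrow> real \<Rightarrow> nat \<Rightarrow> 'n run \<Rightarrow> bool" where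
  "cap_harmless B R \<tau> Kmax \<rho> \<longleftrightarrow>
     \<lfloor>log 2 (real (card (Aut R)))\<rfloor> \<le> int Kmax \<or> (\<nexists>K. cap_stops B R \<tau> Kmax \<rho> K)"

end

theory Submission
  imports Defs
begin

text \<open>At \<open>\<tau> = 0\<close> a permutation passes the test exactly if it is an automorphism. While the current
  group is a proper subgroup of \<open>Aut R\<close>, completeness supplies a new automorphism, which is accepted
  and by Lagrange at least doubles the order of the group; so \<open>Aut R\<close> is reached, and within the cap.
  Once it is reached, deflation makes the next generator orthogonal to every automorphism, so a
  permutation with positive overlap is not one and is rejected.\<close>

text \<open>For \<open>a\<close> in \<open>K\<close> outside \<open>H\<close>, the coset of
  \<open>H\<close> through \<open>a\<close> has as many elements as \<open>H\<close>, is disjoint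
  from it and also lies in \<open>K\<close>.\<close>

lemma (in group) double_card_subgroup_le:
  assumes H: "subgroup H G" and K: "subgroup K G" "finite K" and "H \<subset> K"
  shows "2 * card H \<le> card K"
proof -
  obtain a where a: "a \<in> K" "a \<notin> H"
    using \<open>H \<subset> K\<close> by blast
  have aG: "a \<in> carrier G" and HG: "H \<subseteq> carrier G" and HK: "H \<subseteq> K"
    using a K H \<open>H \<subset> K\<close> by (auto dest: subgroup.mem_carrier)
  have "card ((\<lambda>h. h \<otimes> a) ` H) = card H"
    using aG HG by (intro card_image inj_onI) (auto simp: subset_iff)
  moreover have "H \<inter> (\<lambda>h. h \<otimes> a) ` H = {}"
  proof -
    have "h \<otimes> a \<notin> H" if "h \<in> H" for h
    proof
      assume "h \<otimes> a \<in> H"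
      then have "inv h \<otimes> (h \<otimes> a) \<in> H"
        using H that by (simp add: subgroup.m_closed subgroup.m_inv_closed)
      then show False
        using a aG HG that by (simp add: subset_iff m_assoc [symmetric])
    qed
    then show ?thesis by auto
  qed
  moreover have "finite H"
    using HK K(2) by (rule finite_subset)
  moreover have "H \<union> (\<lambda>h. h \<otimes> a) ` H \<subseteq> K"
    using HK a K by (auto intro: subgroup.m_closed)
  ultimately show ?thesis
    using K(2) card_mono[of K "H \<union> (\<lambda>h. h \<otimes> a) ` H"] by (simp add: card_Un_disjoint)
qed

section \<open>Automorphisms of \<open>R\<close> and the defect test\<close>

lemma perm_mat_mult_commutes_iff:
  fixes R :: "'n::finite cmat"
  assumes "bij \<sigma>"
  shows "perm_mat \<sigma> ** R = R ** perm_mat \<sigma> \<longleftrightarrow> (\<forall>i j. R $ \<sigma> i $ \<sigma> j = R $ i $ j)"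
proof -
  have left: "(perm_mat \<sigma> ** R) $ \<sigma> i $ j = R $ i $ j" for i j
  proof -
    have "(perm_mat \<sigma> ** R) $ \<sigma> i $ j = (\<Sum>k\<in>UNIV. if i = k then R $ k $ j else 0)"
      unfolding perm_mat_def matrix_matrix_mult_def
      by (auto simp: inj_eq[OF bij_is_inj[OF assms]] if_distrib[of "\<lambda>x. x * _"] cong: if_cong)
    then show ?thesis by simp
  qed
  have right: "(R ** perm_mat \<sigma>) $ i $ j = R $ i $ \<sigma> j" for i j
  proof -
    have "(R ** perm_mat \<sigma>) $ i $ j = (\<Sum>k\<in>UNIV. if k = \<sigma> j then R $ i $ k else 0)"
      unfolding perm_mat_def matrix_matrix_mult_def
      by (simp add: if_distrib[of "\<lambda>x. _ * x"] cong: if_cong)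
    then show ?thesis by simp
  qed
  \<comment> \<open>Every row index has the form \<open>\<sigma> i\<close>; reading rows there keeps
    the inverse of \<open>\<sigma>\<close> out of the condition.\<close>
  have "perm_mat \<sigma> ** R = R ** perm_mat \<sigma> \<longleftrightarrow>
      (\<forall>i j. (perm_mat \<sigma> ** R) $ \<sigma> i $ j = (R ** perm_mat \<sigma>) $ \<sigma> i $ j)"
    unfolding vec_eq_iff using surjD[OF bij_is_surj[OF assms]] by metis
  then show ?thesis
    by (auto simp: left right)
qed

text \<open>In this entrywise form, closure under composition and inverses is a matter of
  instantiating indices.\<close>

lemma Aut_eq: "Aut R = {\<sigma>. bij \<sigma> \<and> (\<forall>i j. R $ \<sigma> i $ \<sigma> j = R $ i $ j)}"
  by (auto simp: Aut_def carrier_Sym perm_mat_mult_commutes_iff)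

lemma inv_Sym: "bij \<sigma> \<Longrightarrow> inv\<^bsub>Sym\<^esub> \<sigma> = Hilbert_Choice.inv \<sigma>"
  by (simp add: inv_BijGroup Bij_def restrict_def)

lemma subgroup_Aut: "subgroup (Aut R) Sym"
proof -
  interpret group Sym by (rule group_BijGroup)
  show ?thesis
  proof (rule subgroupI)
    show "Aut R \<subseteq> carrier Sym" "Aut R \<noteq> {}"
      by (auto simp: Aut_eq carrier_Sym intro: exI[of _ id])
    fix \<sigma> assume \<sigma>: "\<sigma> \<in> Aut R"
    then have "bij \<sigma>" and eq: "\<And>i j. R $ \<sigma> i $ \<sigma> j = R $ i $ j"
      by (auto simp: Aut_eq)
    then have "R $ Hilbert_Choice.inv \<sigma> i $ Hilbert_Choice.inv \<sigma> j = R $ i $ j" for i j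
      using eq[of "Hilbert_Choice.inv \<sigma> i" "Hilbert_Choice.inv \<sigma> j"]
      by (simp add: bij_is_surj surj_f_inv_f)
    with \<sigma> show "inv\<^bsub>Sym\<^esub> \<sigma> \<in> Aut R"
      by (auto simp: Aut_eq inv_Sym bij_imp_bij_inv)
    fix \<tau> assume "\<tau> \<in> Aut R"
    with \<sigma> show "\<sigma> \<otimes>\<^bsub>Sym\<^esub> \<tau> \<in> Aut R"
      by (auto simp: Aut_eq mult_Sym bij_comp)
  qed
qed

lemma norm_perm_mat_pos: "0 < norm (perm_mat \<sigma> :: 'n::finite cmat)"
proof -
  \<comment> \<open>\<open>undefined\<close> serves as an arbitrary column index \<open>j\<close>;
    the entry in row \<open>\<sigma> j\<close> is 1.\<close>
  have "(perm_mat \<sigma> :: 'n cmat) $ \<sigma> undefined $ undefined \<noteq> 0"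
    by (simp add: perm_mat_def)
  then show ?thesis
    by (metis zero_index zero_less_norm_iff)
qed

lemma defect_perm_mat_le_0_iff:
  fixes R :: "'n::finite cmat"
  assumes "bij \<sigma>"
  shows "defect (perm_mat \<sigma>) R \<le> 0 \<longleftrightarrow> \<sigma> \<in> Aut R"
proof -
  \<comment> \<open>The denominator vanishes only for \<open>R = 0\<close>, where the quotient is 0
    by convention; the commutator is then 0 as well, so this case merges with the other one.\<close>
  have "defect (perm_mat \<sigma>) R \<le> 0 \<longleftrightarrow> R = 0 \<or> commutator R (perm_mat \<sigma>) = 0"
    unfolding defect_def using norm_perm_mat_pos[of \<sigma>]
    by (auto simp: divide_le_0_iff mult_le_0_iff)
  also have "\<dots> \<longleftrightarrow> commutator R (perm_mat \<sigma>) = 0"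
    by (auto simp: commutator_def matrix_matrix_mult_def vec_eq_iff)
  also have "\<dots> \<longleftrightarrow> \<sigma> \<in> Aut R"
    using assms by (auto simp: Aut_def carrier_Sym commutator_def)
  finally show ?thesis .
qed

section \<open>Overlap, deflation and rounding\<close>

lemma frob_inner_commute: "frob_inner X Y = cnj (frob_inner Y X)"
  unfolding frob_inner_def trace_def conj_transpose_def matrix_matrix_mult_def
  by (simp add: mult.commute)

text \<open>Deflation has the permutation matrix in the first slot of the inner product, the overlap
  has it in the second; conjugate symmetry carries the zero across.\<close>

lemma overlap_deflated:
  assumes "A \<in> deflated B H" "\<sigma> \<in> H"
  shows "overlap A \<sigma> = 0"
proof -
  have "frob_inner (perm_mat \<sigma>) A = 0"
    using assms by (auto simp: deflated_def cmat.span_base)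
  then show ?thesis
    using frob_inner_commute[of A "perm_mat \<sigma>"] by (simp add: overlap_def)
qed

text \<open>Transfers the positive-overlap hypothesis, which speaks of a maximum, to the permutation
  actually chosen.\<close>

lemma overlap_rounding:
  fixes A :: "'n::finite cmat"
  assumes "is_rounding A \<sigma>"
  shows "overlap A \<sigma> = Max (overlap A ` carrier Sym)"
proof -
  have "\<sigma> \<in> carrier Sym" "\<And>\<pi>. \<pi> \<in> carrier Sym \<Longrightarrow> overlap A \<pi> \<le> overlap A \<sigma>"
    using assms by (auto simp: is_rounding_def is_arg_max_def not_less)
  moreover have "finite (carrier (Sym :: ('n \<Rightarrow> 'n) monoid))"
    by simp
  ultimately show ?thesis
    by (intro Max_eqI[symmetric]) auto
qed

section \<open>Growth of the group along a run\<close>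

lemma stage_Suc:
  "stage B R \<tau> Kmax \<rho> (Suc k) \<longleftrightarrow> stage B R \<tau> Kmax \<rho> k \<and> accepts B R \<tau> \<rho> k \<and> Suc k < Kmax"
  by (auto simp: stage_def less_Suc_eq)

text \<open>Zero defect makes the permutation an automorphism; its overlap is positive, whereas
  members of the current group have overlap 0. In particular, nothing can be accepted once the group
  is all of \<open>Aut R\<close>.\<close>

lemma accepts_0_imp_Aut_minus_grp:
  fixes R :: "'n::finite cmat"
  assumes run: "sequential_run B R 0 Kmax \<rho>" and pos: "positive_overlap B R 0 Kmax \<rho>"
    and st: "stage B R 0 Kmax \<rho> k" and acc: "accepts B R 0 \<rho> k"
  shows "prm \<rho> (Suc k) \<in> Aut R - grp \<rho> k"
proof -
  let ?A = "gen \<rho> (Suc k)" and ?\<sigma> = "prm \<rho> (Suc k)"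
  have cand: "has_candidate B \<rho> k" and def: "defect (perm_mat ?\<sigma>) R \<le> 0"
    using acc by (auto simp: accepts_def)
  have opt: "is_optimal_generator B R (grp \<rho> k) ?A" and rnd: "is_rounding ?A ?\<sigma>"
    using run st cand by (auto simp: sequential_run_def)
  have "bij ?\<sigma>"
    using rnd by (simp add: is_rounding_def is_arg_max_def carrier_Sym)
  then have "?\<sigma> \<in> Aut R"
    using def by (simp add: defect_perm_mat_le_0_iff)
  moreover have "0 < overlap ?A ?\<sigma>"
    using pos st cand by (simp add: positive_overlap_def overlap_rounding[OF rnd])
  moreover have "?A \<in> deflated B (grp \<rho> k)"
    using opt by (simp add: is_optimal_generator_def is_arg_min_def)
  ultimately show ?thesis
    using overlap_deflated by fastforce
qed

text \<open>Stated for a single acceptance so that it also covers the last one before the cap, after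
  which stage \<open>Suc k\<close> is not entered.\<close>

lemma grp_Suc_invariant:
  fixes R :: "'n::finite cmat"
  assumes run: "sequential_run B R 0 Kmax \<rho>" and pos: "positive_overlap B R 0 Kmax \<rho>"
    and st: "stage B R 0 Kmax \<rho> k" and acc: "accepts B R 0 \<rho> k"
    and sub: "subgroup (grp \<rho> k) Sym" "grp \<rho> k \<subseteq> Aut R" and card: "2 ^ k \<le> card (grp \<rho> k)"
  shows "subgroup (grp \<rho> (Suc k)) Sym \<and> grp \<rho> (Suc k) \<subseteq> Aut R \<and>
    2 ^ Suc k \<le> card (grp \<rho> (Suc k))"
proof -
  interpret group "Sym :: ('n \<Rightarrow> 'n) monoid" by (rule group_BijGroup)
  let ?\<sigma> = "prm \<rho> (Suc k)"
  have \<sigma>: "?\<sigma> \<in> Aut R" "?\<sigma> \<notin> grp \<rho> k"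
    using accepts_0_imp_Aut_minus_grp[OF run pos st acc] by auto
  have eq: "grp \<rho> (Suc k) = generate Sym (insert ?\<sigma> (grp \<rho> k))"
    using run st acc by (simp add: sequential_run_def accepts_def)
  have ins: "insert ?\<sigma> (grp \<rho> k) \<subseteq> Aut R"
    using \<sigma> sub by simp
  have sub': "subgroup (grp \<rho> (Suc k)) Sym" and le: "grp \<rho> (Suc k) \<subseteq> Aut R"
    unfolding eq using ins subgroup.subset[OF subgroup_Aut]
    by (blast intro: generate_is_subgroup, intro generate_subgroup_incl[OF ins subgroup_Aut])
  have "grp \<rho> k \<subset> grp \<rho> (Suc k)"
    using \<sigma> unfolding eq by (auto intro: generate.incl)
  then have "2 * card (grp \<rho> k) \<le> card (grp \<rho> (Suc k))"
    by (intro double_card_subgroup_le sub sub') simp_all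
  with card sub' le show ?thesis by simp
qed

lemma stage_invariant:
  fixes R :: "'n::finite cmat"
  assumes run: "sequential_run B R 0 Kmax \<rho>" and pos: "positive_overlap B R 0 Kmax \<rho>"
  shows "stage B R 0 Kmax \<rho> k \<Longrightarrow>
    subgroup (grp \<rho> k) Sym \<and> grp \<rho> k \<subseteq> Aut R \<and> 2 ^ k \<le> card (grp \<rho> k)"
proof (induction k)
  case 0
  have "grp \<rho> 0 = {\<one>\<^bsub>Sym\<^esub>}"
    using run by (simp add: sequential_run_def)
  then show ?case
    using subgroup.one_closed[OF subgroup_Aut, of R]
    by (simp add: group.triv_subgroup[OF group_BijGroup])
next
  case (Suc k)
  then show ?case
    using grp_Suc_invariant[OF run pos] by (simp add: stage_Suc)
qed

text \<open>After \<open>K\<close> acceptances the group has order at least \<open>2 ^ K\<close>.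
  Were it proper, \<open>Aut R\<close> would have order at least \<open>2 ^ Suc K\<close>, so the
  logarithm would exceed the cap.\<close>

lemma cap_stops_imp_grp_eq_Aut:
  fixes R :: "'n::finite cmat"
  assumes run: "sequential_run B R 0 Kmax \<rho>" and pos: "positive_overlap B R 0 Kmax \<rho>"
    and harmless: "cap_harmless B R 0 Kmax \<rho>" and cap: "cap_stops B R 0 Kmax \<rho> K"
  shows "grp \<rho> K = Aut R"
proof (rule ccontr)
  interpret group "Sym :: ('n \<Rightarrow> 'n) monoid" by (rule group_BijGroup)
  obtain k where k: "K = Suc k" "stage B R 0 Kmax \<rho> k" "accepts B R 0 \<rho> k" "Kmax \<le> K"
    using cap by (auto simp: cap_stops_def)
  have inv: "subgroup (grp \<rho> K) Sym" "grp \<rho> K \<subseteq> Aut R" "2 ^ K \<le> card (grp \<rho> K)"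
    using grp_Suc_invariant[OF run pos k(2,3)] stage_invariant[OF run pos k(2)] k(1) by auto
  assume "grp \<rho> K \<noteq> Aut R"
  then have "2 * card (grp \<rho> K) \<le> card (Aut R)"
    using inv by (intro double_card_subgroup_le subgroup_Aut) auto
  with inv(3) have "2 ^ Suc K \<le> card (Aut R)"
    by simp
  then have "real (Suc K) \<le> log 2 (real (card (Aut R)))"
    by (intro le_log2_of_power)
  moreover have "\<lfloor>log 2 (real (card (Aut R)))\<rfloor> \<le> int Kmax"
    using harmless cap by (auto simp: cap_harmless_def)
  ultimately show False
    using k(4) by linarith
qed

theorem theorem11p6:
  fixes E :: "'n::finite \<Rightarrow> 'n \<Rightarrow> bool"
    and f :: "complex \<Rightarrow> complex"
    and R :: "complex^'n^'n"
    and B :: "(complex^'n^'n) set"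
    and Kmax :: nat
    and \<rho> :: "'n run"
  assumes "simple_graph E"
    and "inj_on f (spec (laplacian E))"
    and "is_matrix_fun f (laplacian E) R"
    and "hermitian_mat R"
    and "finite B"
    and "sequential_run B R 0 Kmax \<rho>"
    and "positive_overlap B R 0 Kmax \<rho>"
    and "generating_complete B R 0 Kmax \<rho>"
    and "cap_harmless B R 0 Kmax \<rho>"
  shows "\<exists>K. halts_at B R 0 Kmax \<rho> K \<and> grp \<rho> K = Aut R"
proof (rule ccontr)
  note run = assms(6) and pos = assms(7)
  assume not_halts: "\<nexists>K. halts_at B R 0 Kmax \<rho> K \<and> grp \<rho> K = Aut R"
  \<comment> \<open>A run that never halts with \<open>Aut R\<close> would pass through every stage,
    which the doubling of orders forbids.\<close>
  have "stage B R 0 Kmax \<rho> k" for k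
  proof (induction k)
    case 0
    show ?case by (simp add: stage_def)
  next
    case (Suc k)
    have acc: "accepts B R 0 \<rho> k"
    proof (cases "grp \<rho> k = Aut R")
      case True
      \<comment> \<open>A rejection here would be a halt with the full group; the contradiction with
        acceptance is left to the final count.\<close>
      with Suc not_halts show ?thesis by (auto simp: halts_at_def)
    next
      case False
      with stage_invariant[OF run pos Suc] have "grp \<rho> k \<subset> Aut R" by blast
      then have "has_candidate B \<rho> k" and \<sigma>: "prm \<rho> (Suc k) \<in> Aut R"
        using assms(8) Suc by (auto simp: generating_complete_def)
      moreover have "bij (prm \<rho> (Suc k))"
        using \<sigma> by (simp add: Aut_eq)
      ultimately show ?thesis
        by (simp add: accepts_def defect_perm_mat_le_0_iff)
    qed
    have "\<not> cap_stops B R 0 Kmax \<rho> (Suc k)"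
      using not_halts cap_stops_imp_grp_eq_Aut[OF run pos assms(9)] by (auto simp: halts_at_def)
    with Suc acc show ?case
      by (auto simp: stage_Suc cap_stops_def)
  qed
  \<comment> \<open>Stage \<open>n = card (Aut R)\<close> is late enough, since
    \<open>n < 2 ^ n\<close>.\<close>
  then have "2 ^ card (Aut R) \<le> card (grp \<rho> (card (Aut R)))"
    and "grp \<rho> (card (Aut R)) \<subseteq> Aut R"
    using stage_invariant[OF run pos] by blast+
  then have "2 ^ card (Aut R) \<le> card (Aut R)"
    by (meson card_mono finite order_trans)
  then show False
    using less_exp[of "card (Aut R)"] by simp
qed

end
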